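(* Let $G$ be an even graph with maximum degree $\Delta$. Then $G$ can be decomposed into $\frac{\Delta}{2}$ $2$-regular graphs; that is, $E(G)$ can be partitioned into $\frac{\Delta}{2}$ sets each of which is the edge set of a $2$-regular subgraph of $G$. Hence, for every even graph $G$ with maximum degree $\Delta$, $f_{re}(G)=\frac{\Delta}{2}$.
   Context: Graphs are finite and simple, with at least one vertex. A graph is even if every vertex has even degree. A $2$-regular subgraph of $G$ is a subgraph in which every vertex has degree exactly $2$; it need be neither connected nor spanning. A decomposition of $G=(V,E)$ into $2$-regular subgraphs and edges is a partition $E_1,\dots,E_k$ of $E$ such that each subgraph $H_i=(V(E_i),E_i)$ is $2$-regular or a single edge, where $V(E_i)$ is the set of vertices incident to edges in $E_i$ (the empty partition, $k=0$, is used if $E=\emptyset$). $f_{re}(G)$ denotes the minimum number $k$ of subgraphs in a decomposition of $G$ into $2$-regular subgraphs and edges. *)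

theory Defs
  imports Complex_Main "HOL-Library.Disjoint_Sets"
begin

text \<open>A graph is given by its vertex set \<open>V\<close> and its edge set \<open>E\<close>, an edge being the
  two-element set of its ends.\<close>

definition simple_graph :: "'a set \<Rightarrow> 'a set set \<Rightarrow> bool" where
  "simple_graph V E \<longleftrightarrow>
     finite V \<and> V \<noteq> {} \<and> (\<forall>e\<in>E. \<exists>u\<in>V. \<exists>v\<in>V. u \<noteq> v \<and> e = {u, v})"

definition degree :: "'a set set \<Rightarrow> 'a \<Rightarrow> nat" where
  "degree E v = card {e \<in> E. v \<in> e}"

definition max_degree :: "'a set \<Rightarrow> 'a set set \<Rightarrow> nat" where
  "max_degree V E = Max (degree E ` V)"

definition even_graph :: "'a set \<Rightarrow> 'a set set \<Rightarrow> bool" where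
  "even_graph V E \<longleftrightarrow> simple_graph V E \<and> (\<forall>v\<in>V. even (degree E v))"

definition subgraph :: "'a set \<Rightarrow> 'a set set \<Rightarrow> 'a set \<Rightarrow> 'a set set \<Rightarrow> bool" where
  "subgraph W F V E \<longleftrightarrow> simple_graph W F \<and> W \<subseteq> V \<and> F \<subseteq> E"

definition two_regular_subgraph :: "'a set \<Rightarrow> 'a set set \<Rightarrow> 'a set \<Rightarrow> 'a set set \<Rightarrow> bool" where
  "two_regular_subgraph W F V E \<longleftrightarrow> subgraph W F V E \<and> (\<forall>v\<in>W. degree F v = 2)"

definition incident_vertices :: "'a set set \<Rightarrow> 'a set" where
  "incident_vertices F = {v. \<exists>e\<in>F. v \<in> e}"

text \<open>Since \<^const>\<open>partition_on\<close> requires nonempty and pairwise disjoint parts,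
  a partition \<open>E\<^sub>1, \<dots>, E\<^sub>k\<close> is the set of its parts, \<open>k\<close> is the cardinality
  of that set, and the empty edge set has exactly the empty partition.\<close>

definition re_decomposition :: "'a set \<Rightarrow> 'a set set \<Rightarrow> 'a set set set \<Rightarrow> bool" where
  "re_decomposition V E P \<longleftrightarrow>
     partition_on E P \<and>
     (\<forall>F\<in>P. two_regular_subgraph (incident_vertices F) F V E \<or> (\<exists>e. F = {e}))"

definition f_re :: "'a set \<Rightarrow> 'a set set \<Rightarrow> nat" where
  "f_re V E = (LEAST k. \<exists>P. re_decomposition V E P \<and> card P = k)"

text \<open>The minimum is attained, because the decomposition into single edges always exists.\<close>

lemma f_re_attained: "\<exists>P. re_decomposition V E P \<and> card P = f_re V E"
proof -
  have "partition_on E ((\<lambda>e. {e}) ` E)"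
    by (rule partition_onI) (auto simp: disjnt_def)
  then have "re_decomposition V E ((\<lambda>e. {e}) ` E)"
    unfolding re_decomposition_def by blast
  then have "\<exists>k P. re_decomposition V E P \<and> card P = k"
    by blast
  then show ?thesis
    unfolding f_re_def by (rule LeastI_ex)
qed

end

theory Submission imports Defs begin

text \<open>An even graph has an orientation in which every vertex has equal in- and outdegree, hence
  outdegree at most \<open>k = \<Delta>/2\<close>. After adding \<open>k\<close> minus outdegree loops at every vertex,
  the arcs form a \<open>k\<close>-regular bipartite multigraph between tails and heads, so Hall's theorem yields
  a permutation of the vertices along arcs and loops. It has no 2-cycles, since each edge is oriented
  only once, so that without its fixed points it is a
  2-regular subgraph that covers every vertex of degree \<open>\<Delta>\<close>; it is removed and one
  iterates. Conversely, each part of a decomposition covers at most two edges at a vertex of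
  degree \<open>\<Delta>\<close>.\<close>

section \<open>Hall's theorem\<close>

text \<open>Rado's proof: if neither of two elements of \<open>A i\<close> could be discarded, then
  submodularity of the cardinality of unions would contradict Hall's condition.\<close>

lemma hall_marriage:
  assumes "finite I"
    and "\<And>i. i \<in> I \<Longrightarrow> finite (A i)"
    and "\<And>J. J \<subseteq> I \<Longrightarrow> card J \<le> card (\<Union>(A ` J))"
  shows "\<exists>R. inj_on R I \<and> (\<forall>i\<in>I. R i \<in> A i)"
  using assms(2,3)
proof (induction "\<Sum>i\<in>I. card (A i)" arbitrary: A rule: less_induct)
  case less
  note fin = less.prems(1) and hall = less.prems(2)
  show ?case
  proof (cases "\<exists>i\<in>I. \<exists>x\<in>A i. \<exists>y\<in>A i. x \<noteq> y")
    case False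
    \<comment> \<open>Every \<open>A i\<close> has at most one element here: Hall's condition for
      singletons makes it nonempty, for pairs it makes the representatives distinct.\<close>
    have ne: "A i \<noteq> {}" if "i \<in> I" for i
      using hall[of "{i}"] that by auto
    define R where "R i = (SOME x. x \<in> A i)" for i
    have R: "A i = {R i}" if "i \<in> I" for i
    proof -
      have "R i \<in> A i"
        unfolding R_def using ne[OF that] by (simp add: some_in_eq)
      then show ?thesis using False that by blast
    qed
    have "inj_on R I"
    proof (rule inj_onI, rule ccontr)
      fix i j assume ij: "i \<in> I" "j \<in> I" "R i = R j" "i \<noteq> j"
      then have "card {i, j} \<le> card (A i \<union> A j)"
        using hall[of "{i, j}"] by simp
      then show False using ij R[of i] R[of j] by simp
    qed
    then show ?thesis using R by blast
  next
    case True
    then obtain i x y where i: "i \<in> I" and xy: "x \<in> A i" "y \<in> A i" "x \<noteq> y" by blast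
    \<comment> \<open>If discarding \<open>z\<close> destroys Hall's condition, a violating index
      set must contain \<open>i\<close>. The \<open>J\<close> stated here is that set without
      \<open>i\<close>, so the strict inequality becomes a weak one.\<close>
    have reduce: "?thesis \<or> (\<exists>J. J \<subseteq> I \<and> i \<notin> J \<and>
        card (\<Union>(A ` J) \<union> (A i - {z})) \<le> card J)" if z: "z \<in> A i" for z
    proof -
      define B where "B = A(i := A i - {z})"
      have fB: "finite (B j)" if "j \<in> I" for j
        using fin that i by (auto simp: B_def)
      have lt: "(\<Sum>j\<in>I. card (B j)) < (\<Sum>j\<in>I. card (A j))"
      proof (rule sum_strict_mono_ex1[OF assms(1)])
        show "\<forall>j\<in>I. card (B j) \<le> card (A j)"
          using fin by (auto simp: B_def intro!: card_mono)
        have "card (A i - {z}) < card (A i)"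
          using fin[OF i] z by (rule card_Diff1_less)
        then show "\<exists>j\<in>I. card (B j) < card (A j)"
          using i by (auto simp: B_def)
      qed
      show ?thesis
      proof (cases "\<forall>J\<subseteq>I. card J \<le> card (\<Union>(B ` J))")
        case True
        then have "\<exists>R. inj_on R I \<and> (\<forall>j\<in>I. R j \<in> B j)"
          using less.hyps[OF lt] fB by blast
        moreover have "B j \<subseteq> A j" for j by (auto simp: B_def)
        ultimately show ?thesis by blast
      next
        case False
        then obtain J where J: "J \<subseteq> I" "card (\<Union>(B ` J)) < card J" by (meson not_le)
        have "i \<in> J"
        proof (rule ccontr)
          assume "i \<notin> J"
          then have "\<Union>(B ` J) = \<Union>(A ` J)" by (auto simp: B_def)
          then show False using J hall[of J] by simp
        qed
        moreover have "finite J" using J(1) assms(1) by (rule finite_subset)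
        ultimately have "card J = Suc (card (J - {i}))" by (metis card.remove)
        moreover have "\<Union>(B ` J) = \<Union>(A ` (J - {i})) \<union> (A i - {z})"
          using \<open>i \<in> J\<close> by (auto simp: B_def split: if_splits)
        ultimately have "card (\<Union>(A ` (J - {i})) \<union> (A i - {z})) \<le> card (J - {i})"
          using J(2) by simp
        then show ?thesis using J(1) by blast
      qed
    qed
    show ?thesis
    proof (rule ccontr)
      assume no: "\<not> ?thesis"
      obtain J where J: "J \<subseteq> I" "i \<notin> J" "card (\<Union>(A ` J) \<union> (A i - {x})) \<le> card J"
        using reduce[OF xy(1)] no by blast
      obtain K where K: "K \<subseteq> I" "i \<notin> K" "card (\<Union>(A ` K) \<union> (A i - {y})) \<le> card K"
        using reduce[OF xy(2)] no by blast
      define P where "P = \<Union>(A ` J) \<union> (A i - {x})"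
      define Q where "Q = \<Union>(A ` K) \<union> (A i - {y})"
      have fJK: "finite J" "finite K" using J(1) K(1) assms(1) finite_subset by blast+
      have fPQ: "finite P" "finite Q"
        using fJK J(1) K(1) fin i by (auto simp: P_def Q_def)
      \<comment> \<open>As \<open>x\<close> and \<open>y\<close> differ, the union restores all of
        \<open>A i\<close>, and Hall's condition can count \<open>i\<close> as an extra index. This
        surplus of one is the contradiction.\<close>
      have "P \<union> Q = \<Union>(A ` insert i (J \<union> K))"
        using xy by (auto simp: P_def Q_def)
      then have "Suc (card (J \<union> K)) \<le> card (P \<union> Q)"
        using hall[of "insert i (J \<union> K)"] J K i fJK by simp
      moreover have "card (J \<inter> K) \<le> card (P \<inter> Q)"
      proof -
        have "card (J \<inter> K) \<le> card (\<Union>(A ` (J \<inter> K)))" using hall[of "J \<inter> K"] J by blast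
        also have "\<dots> \<le> card (P \<inter> Q)" using fPQ by (intro card_mono) (auto simp: P_def Q_def)
        finally show ?thesis .
      qed
      moreover have "card P + card Q = card (P \<union> Q) + card (P \<inter> Q)"
        using fPQ by (rule card_Un_Int)
      moreover have "card J + card K = card (J \<union> K) + card (J \<inter> K)"
        using fJK by (rule card_Un_Int)
      moreover have "card P \<le> card J" "card Q \<le> card K"
        using J(3) K(3) by (auto simp: P_def Q_def)
      ultimately show False by linarith
    qed
  qed
qed

section \<open>Balanced orientations\<close>

text \<open>For the maps \<open>s\<close> and \<open>t\<close> to tails and heads, these are the
  out- and indegrees; a loop counts once in each.\<close>

definition fiber_card :: "('i \<Rightarrow> 'a) \<Rightarrow> 'i set \<Rightarrow> 'a \<Rightarrow> nat" where
  "fiber_card f I v = card {i \<in> I. f i = v}"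

lemma fiber_card_empty [simp]: "fiber_card f {} v = 0"
  by (simp add: fiber_card_def)

lemma fiber_card_insert [simp]:
  assumes "finite I" "i \<notin> I"
  shows "fiber_card f (insert i I) v = of_bool (f i = v) + fiber_card f I v"
proof -
  have "{j \<in> insert i I. f j = v} = (if f i = v then insert i {j \<in> I. f j = v} else {j \<in> I. f j = v})"
    by auto
  then show ?thesis using assms by (simp add: fiber_card_def)
qed

lemma fiber_card_upd [simp]: "i \<notin> I \<Longrightarrow> fiber_card (f(i := x)) I v = fiber_card f I v"
  unfolding fiber_card_def by (rule arg_cong[where f = card]) auto

lemma sum_fiber_card:
  assumes "finite I" "finite J"
  shows "(\<Sum>v\<in>J. fiber_card f I v) = card {i \<in> I. f i \<in> J}"
proof -
  have "{i \<in> I. f i \<in> J} = (\<Union>v\<in>J. {i \<in> I. f i = v})" by auto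
  then show ?thesis
    using assms by (simp add: fiber_card_def card_UN_disjoint disjoint_iff)
qed

text \<open>The multigraph has edges \<open>I\<close> with ends \<open>s i\<close> and \<open>t i\<close>, so that one may
  split off: two edges \<open>uv\<close> and \<open>vw\<close> are replaced by a single edge \<open>uw\<close>,
  possibly a loop or a parallel edge, whose orientation is then pulled back to the path.\<close>

lemma balanced_orientation:
  assumes "finite I" "\<And>v. even (fiber_card s I v + fiber_card t I v)"
  shows "\<exists>s' t'. (\<forall>i\<in>I. {s' i, t' i} = {s i, t i}) \<and>
    (\<forall>v. fiber_card s' I v = fiber_card t' I v)"
  using assms
proof (induction I arbitrary: s t rule: finite_induct)
  case empty
  then show ?case by simp
next
  case (insert i I)
  note ev = insert.prems
  show ?case
  proof (cases "s i = t i")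
    case True
    \<comment> \<open>A loop contributes two to the degree of its vertex and is balanced by
      itself.\<close>
    have "even (fiber_card s I v + fiber_card t I v)" for v
      using ev[of v] insert.hyps True by (cases "t i = v") auto
    from insert.IH[OF this] obtain s' t' where st: "\<forall>j\<in>I. {s' j, t' j} = {s j, t j}"
        "\<forall>v. fiber_card s' I v = fiber_card t' I v"
      by blast
    show ?thesis
    proof (rule exI[of _ "s'(i := s i)"], rule exI[of _ "t'(i := t i)"], intro conjI ballI allI)
      fix j assume "j \<in> insert i I"
      then show "{(s'(i := s i)) j, (t'(i := t i)) j} = {s j, t j}"
        using st(1) insert.hyps(2) by (cases "j = i") simp_all
    next
      fix v
      show "fiber_card (s'(i := s i)) (insert i I) v = fiber_card (t'(i := t i)) (insert i I) v"
        using st(2) insert.hyps True by simp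
    qed
  next
    case False
    define u v where "u = s i" and "v = t i"
    have uv: "s i = u" "t i = v" "u \<noteq> v" using False by (auto simp: u_def v_def)
    \<comment> \<open>The non-loop \<open>i\<close> contributes exactly one at \<open>v\<close>, so
      evenness forces another edge \<open>j\<close> there.\<close>
    have "fiber_card s I v + fiber_card t I v \<noteq> 0"
      using ev[of v] insert.hyps uv by (auto simp del: add_is_0)
    then obtain j where j: "j \<in> I" "s j = v \<or> t j = v"
      by (auto simp: fiber_card_def card_eq_0_iff)
    define w where "w = (if s j = v then t j else s j)"
    have w: "s j = v \<and> t j = w \<or> s j = w \<and> t j = v" using j(2) by (auto simp: w_def)
    define K where "K = I - {j}"
    have K: "I = insert j K" "finite K" "j \<notin> K" "i \<notin> K" "i \<noteq> j"
      using j(1) insert.hyps by (auto simp: K_def)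
    \<comment> \<open>The index \<open>j\<close> is reused for the edge \<open>uw\<close>: the
      degree drops by two at \<open>v\<close> and is unchanged elsewhere.\<close>
    have "even (fiber_card (s(j := u)) I x + fiber_card (t(j := w)) I x)" for x
      using ev[of x] uv w K by (auto simp: of_bool_def split: if_splits)
    from insert.IH[OF this] obtain s' t' where st: "\<forall>k\<in>I. {s' k, t' k} = {(s(j := u)) k, (t(j := w)) k}"
        "\<forall>x. fiber_card s' I x = fiber_card t' I x"
      by blast
    have stK: "{s' k, t' k} = {s k, t k}" if "k \<in> K" for k
      using st(1) that K by auto
    have bal: "of_bool (s' j = x) + fiber_card s' K x = of_bool (t' j = x) + fiber_card t' K x" for x
      using st(2) K by simp
    have "{s' j, t' j} = {u, w}" using st(1) j(1) by auto
    then consider "s' j = u" "t' j = w" | "s' j = w" "t' j = u" by (auto simp: doubleton_eq_iff)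
    then show ?thesis
    proof cases
      \<comment> \<open>The path becomes u -> v -> w, or w -> v -> u in the other case; either way
        \<open>v\<close> gains one outgoing and one incoming arc.\<close>
      case 1
      show ?thesis
      proof (rule exI[of _ "s'(i := u, j := v)"], rule exI[of _ "t'(i := v)"], intro conjI ballI allI)
        fix k assume "k \<in> insert i I"
        then show "{(s'(i := u, j := v)) k, (t'(i := v)) k} = {s k, t k}"
          using stK K uv w 1 by auto
      next
        fix x
        show "fiber_card (s'(i := u, j := v)) (insert i I) x = fiber_card (t'(i := v)) (insert i I) x"
          using bal[of x] K 1 by simp
      qed
    next
      case 2
      show ?thesis
      proof (rule exI[of _ "s'(i := v)"], rule exI[of _ "t'(i := u, j := v)"], intro conjI ballI allI)
        fix k assume "k \<in> insert i I"
        then show "{(s'(i := v)) k, (t'(i := u, j := v)) k} = {s k, t k}"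
          using stK K uv w 2 by auto
      next
        fix x
        show "fiber_card (s'(i := v)) (insert i I) x = fiber_card (t'(i := u, j := v)) (insert i I) x"
          using bal[of x] K 2 by simp
      qed
    qed
  qed
qed

lemma simple_graph_finite_edges: "simple_graph V E \<Longrightarrow> finite E"
  unfolding simple_graph_def by (rule finite_subset[of _ "Pow V"]) auto

lemma degree_eq_fiber_card:
  assumes "finite E" "\<And>e. e \<in> E \<Longrightarrow> e = {s e, t e}" "\<And>e. e \<in> E \<Longrightarrow> s e \<noteq> t e"
  shows "degree E v = fiber_card s E v + fiber_card t E v"
proof -
  have "v \<in> e \<longleftrightarrow> s e = v \<or> t e = v" if "e \<in> E" for e
    by (subst assms(2)[OF that]) auto
  then have "{e \<in> E. v \<in> e} = {e \<in> E. s e = v} \<union> {e \<in> E. t e = v}"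
    by blast
  moreover have "{e \<in> E. s e = v} \<inter> {e \<in> E. t e = v} = {}"
    using assms(3) by fastforce
  ultimately show ?thesis
    using assms(1) by (simp add: degree_def fiber_card_def card_Un_disjoint)
qed

text \<open>The edge set indexes itself, with arbitrarily chosen ends. Reorienting keeps the pair of
  ends, so distinctness and membership in \<open>V\<close> carry over.\<close>

lemma even_graph_orientation:
  assumes "even_graph V E"
  obtains s t where "\<And>e. e \<in> E \<Longrightarrow> e = {s e, t e}"
    and "\<And>e. e \<in> E \<Longrightarrow> s e \<noteq> t e \<and> s e \<in> V \<and> t e \<in> V"
    and "\<And>v. fiber_card s E v = fiber_card t E v"
proof -
  have sg: "simple_graph V E" and ev: "\<And>v. v \<in> V \<Longrightarrow> even (degree E v)"
    using assms by (auto simp: even_graph_def)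
  have fE: "finite E" using sg by (rule simple_graph_finite_edges)
  have "\<forall>e\<in>E. \<exists>p. e = {fst p, snd p} \<and> fst p \<noteq> snd p \<and> fst p \<in> V \<and> snd p \<in> V"
    using sg unfolding simple_graph_def by fastforce
  then obtain p where p: "\<And>e. e \<in> E \<Longrightarrow>
      e = {fst (p e), snd (p e)} \<and> fst (p e) \<noteq> snd (p e) \<and> fst (p e) \<in> V \<and> snd (p e) \<in> V"
    by metis
  have "even (fiber_card (fst \<circ> p) E v + fiber_card (snd \<circ> p) E v)" for v
  proof -
    have "degree E v = fiber_card (fst \<circ> p) E v + fiber_card (snd \<circ> p) E v"
      by (rule degree_eq_fiber_card[OF fE]) (use p in \<open>unfold o_apply, blast+\<close>)
    \<comment> \<open>\<open>balanced_orientation\<close> asks for evenness at every element of the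
      type; outside \<open>V\<close> the degree is 0.\<close>
    moreover have "even (degree E v)"
    proof (cases "v \<in> V")
      case False
      moreover have "e \<subseteq> V" if "e \<in> E" for e
        using that sg by (auto simp: simple_graph_def)
      ultimately have "{e \<in> E. v \<in> e} = {}" by blast
      then show ?thesis by (simp only: degree_def card.empty even_zero)
    qed (rule ev)
    ultimately show ?thesis by simp
  qed
  from balanced_orientation[OF fE this] obtain s t where st: "\<forall>e\<in>E. {s e, t e} = {(fst \<circ> p) e, (snd \<circ> p) e}"
      "\<forall>v. fiber_card s E v = fiber_card t E v"
    by blast
  have ends: "{s e, t e} = {fst (p e), snd (p e)}" if "e \<in> E" for e
    using st(1) that by simp
  show ?thesis
  proof (rule that)
    show "e = {s e, t e}" if "e \<in> E" for e
      using p[OF that] ends[OF that] by metis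
    show "s e \<noteq> t e \<and> s e \<in> V \<and> t e \<in> V" if "e \<in> E" for e
    proof -
      have "fst (p e) \<noteq> snd (p e)" "fst (p e) \<in> V" "snd (p e) \<in> V"
        using p[OF that] by blast+
      then show ?thesis using ends[OF that, unfolded doubleton_eq_iff] by auto
    qed
    show "fiber_card s E v = fiber_card t E v" for v using st(2) by blast
  qed
qed

section \<open>Decomposition into 2-regular subgraphs\<close>

text \<open>\<open>F\<close> may miss vertices of smaller degree; meeting those of degree
  \<open>2 * k\<close> is what lets the degree bound fall by two when \<open>F\<close> is
  removed.\<close>

lemma even_graph_two_factor:
  assumes "even_graph V E" "k > 0" "\<And>v. v \<in> V \<Longrightarrow> degree E v \<le> 2 * k"
  obtains F where "F \<subseteq> E" "\<And>v. v \<in> V \<Longrightarrow> degree F v = 0 \<or> degree F v = 2"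
    and "\<And>v. v \<in> V \<Longrightarrow> degree E v = 2 * k \<Longrightarrow> degree F v = 2"
proof -
  have sg: "simple_graph V E" using assms(1) by (simp add: even_graph_def)
  have fE: "finite E" using sg by (rule simple_graph_finite_edges)
  have fV: "finite V" using sg by (simp add: simple_graph_def)
  obtain s t where edge: "\<And>e. e \<in> E \<Longrightarrow> e = {s e, t e}"
    and st: "\<And>e. e \<in> E \<Longrightarrow> s e \<noteq> t e \<and> s e \<in> V \<and> t e \<in> V"
    and bal: "\<And>v. fiber_card s E v = fiber_card t E v"
    using even_graph_orientation[OF assms(1)] by blast
  have deg: "degree E v = 2 * fiber_card s E v" for v
    using degree_eq_fiber_card[OF fE edge, of v] st bal[of v] by simp
  define out where "out = fiber_card s E"
  have out_le: "out v \<le> k" if "v \<in> V" for v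
    using assms(3)[OF that] deg[of v] by (simp add: out_def)
  \<comment> \<open>The candidates for the image of \<open>v\<close>. The \<open>k - out v\<close>
    loops at \<open>v\<close> yield one candidate; their number matters only in the count
    below.\<close>
  define A where "A v = t ` {e \<in> E. s e = v} \<union> (if out v < k then {v} else {})" for v
  have AV: "A v \<subseteq> V" if "v \<in> V" for v using that st by (auto simp: A_def)
  have "\<exists>R. inj_on R V \<and> (\<forall>v\<in>V. R v \<in> A v)"
  proof (rule hall_marriage[OF fV])
    show "finite (A v)" for v using fE by (simp add: A_def)
  next
    fix J assume J: "J \<subseteq> V"
    define N where "N = \<Union>(A ` J)"
    have NV: "N \<subseteq> V" using AV J by (auto simp: N_def)
    have fin: "finite J" "finite N" using J NV fV finite_subset by blast+
    \<comment> \<open>Arcs leaving \<open>J\<close> enter \<open>N\<close>, and by balance the arcs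
      entering \<open>N\<close> are as many as those leaving it.\<close>
    have "{e \<in> E. s e \<in> J} \<subseteq> {e \<in> E. t e \<in> N}" by (auto simp: N_def A_def)
    then have arcs: "sum out J \<le> sum out N"
      using fE fin sum_fiber_card[of E J s] sum_fiber_card[of E N t] bal
      by (simp add: out_def card_mono)
    \<comment> \<open>A vertex of \<open>J\<close> that carries a loop lies in \<open>N\<close>
      itself.\<close>
    have "(\<Sum>v\<in>J. k - out v) = (\<Sum>v\<in>{v \<in> J. out v < k}. k - out v)"
      using fin by (intro sum.mono_neutral_right) auto
    also have "\<dots> \<le> (\<Sum>v\<in>N. k - out v)"
      using fin by (intro sum_mono2) (auto simp: N_def A_def)
    finally have loops: "(\<Sum>v\<in>J. k - out v) \<le> (\<Sum>v\<in>N. k - out v)" .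
    \<comment> \<open>Truncated subtraction is exact here, because \<open>out v\<close> is at most
      \<open>k\<close> on \<open>V\<close>.\<close>
    have total: "sum out X + (\<Sum>v\<in>X. k - out v) = k * card X" if "X \<subseteq> V" for X
    proof -
      have "sum out X + (\<Sum>v\<in>X. k - out v) = (\<Sum>v\<in>X. k)"
        unfolding sum.distrib[symmetric] using that out_le by (intro sum.cong) auto
      then show ?thesis by simp
    qed
    have "k * card J \<le> k * card N"
      using arcs loops total[OF J] total[OF NV] by linarith
    then show "card J \<le> card (\<Union>(A ` J))" using assms(2) by (simp add: N_def)
  qed
  then obtain R where R: "inj_on R V" "\<And>v. v \<in> V \<Longrightarrow> R v \<in> A v" by blast
  have "R ` V \<subseteq> V" using R(2) AV by blast
  then have RV: "R ` V = V" by (rule endo_inj_surj[OF fV _ R(1)])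
  define F where "F = {e \<in> E. R (s e) = t e}"
  have FE: "F \<subseteq> E" by (auto simp: F_def)
  have fF: "finite F" using FE fE by (rule finite_subset)
  \<comment> \<open>A fixed point starts no edge of \<open>F\<close>, as tails and heads differ. A
    moved vertex starts exactly one, since an edge is determined by its ends.\<close>
  have s_fiber: "fiber_card s F v = of_bool (R v \<noteq> v)" if v: "v \<in> V" for v
  proof (cases "R v = v")
    case True
    then have none: "{e \<in> F. s e = v} = {}" using st by (force simp: F_def)
    show ?thesis unfolding fiber_card_def none using True by simp
  next
    case False
    then obtain e where e: "e \<in> E" "s e = v" "t e = R v"
      using R(2)[OF v] by (auto simp: A_def split: if_splits)
    have "{e \<in> F. s e = v} = {e}"
    proof
      show "{e} \<subseteq> {e \<in> F. s e = v}" using e by (simp add: F_def)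
      show "{e \<in> F. s e = v} \<subseteq> {e}"
      proof
        fix f assume "f \<in> {e \<in> F. s e = v}"
        then have "f \<in> E" "s f = v" "t f = R v" by (auto simp: F_def)
        then have "f = e" using e edge[of f] edge[of e] by metis
        then show "f \<in> {e}" by simp
      qed
    qed
    then show ?thesis using False unfolding fiber_card_def by simp
  qed
  have t_fiber: "fiber_card t F (R v) = fiber_card s F v" if v: "v \<in> V" for v
  proof -
    have "{e \<in> F. t e = R v} = {e \<in> F. s e = v}"
      using st v inj_onD[OF R(1)] by (auto simp: F_def)
    then show ?thesis by (simp only: fiber_card_def)
  qed
  have degF: "degree F v = 2 * of_bool (R v \<noteq> v)" if v: "v \<in> V" for v
  proof -
    obtain u where u: "u \<in> V" "v = R u" using v RV by blast
    \<comment> \<open>An injective map moves a vertex iff it moves its image, so a moved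
      \<open>v\<close> also has one entering edge. This edge differs from the leaving one, being
      oriented only once; hence degree 2.\<close>
    have "R u \<noteq> u \<longleftrightarrow> R v \<noteq> v" using u v R(1) by (metis inj_onD)
    then have "fiber_card t F v = of_bool (R v \<noteq> v)"
      using t_fiber[OF u(1)] s_fiber[OF u(1)] u(2) by simp
    moreover have "degree F v = fiber_card s F v + fiber_card t F v"
      by (rule degree_eq_fiber_card[OF fF]) (use FE edge st in blast)+
    ultimately show ?thesis using s_fiber[OF v] by simp
  qed
  show ?thesis
  proof (rule that[OF FE])
    show "degree F v = 0 \<or> degree F v = 2" if "v \<in> V" for v
      using degF[OF that] by simp
    show "degree F v = 2" if v: "v \<in> V" "degree E v = 2 * k" for v
    proof -
      \<comment> \<open>Here \<open>out v = k\<close>, so \<open>v\<close> has no loop and cannot be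
        fixed.\<close>
      have "A v = t ` {e \<in> E. s e = v}" using v(2) deg[of v] by (simp add: A_def out_def)
      then have "R v \<noteq> v" using R(2)[OF v(1)] st by force
      then show ?thesis using degF[OF v(1)] by simp
    qed
  qed
qed

lemma degree_Diff:
  assumes "finite E" "F \<subseteq> E"
  shows "degree (E - F) v = degree E v - degree F v"
proof -
  have "{e \<in> E - F. v \<in> e} = {e \<in> E. v \<in> e} - {e \<in> F. v \<in> e}" by auto
  moreover have "{e \<in> F. v \<in> e} \<subseteq> {e \<in> E. v \<in> e}" using assms(2) by auto
  ultimately show ?thesis
    unfolding degree_def using assms by (simp add: card_Diff_subset finite_subset)
qed

text \<open>Passing to the incident vertices drops exactly the vertices of degree 0. Nonemptiness of
  \<open>F\<close> provides the vertex that \<open>simple_graph\<close> demands.\<close>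

lemma two_regular_subgraph_incident_vertices:
  assumes "simple_graph V E" "F \<subseteq> E" "F \<noteq> {}"
    and "\<And>v. v \<in> V \<Longrightarrow> degree F v = 0 \<or> degree F v = 2"
  shows "two_regular_subgraph (incident_vertices F) F V E"
proof -
  have ends: "\<exists>u\<in>V. \<exists>v\<in>V. u \<noteq> v \<and> e = {u, v}" if "e \<in> F" for e
    using that assms(1,2) by (auto simp: simple_graph_def)
  have sub: "incident_vertices F \<subseteq> V"
    using ends by (fastforce simp: incident_vertices_def)
  have fV: "finite V" using assms(1) by (simp add: simple_graph_def)
  have fF: "finite F"
    using simple_graph_finite_edges[OF assms(1)] assms(2) by (rule rev_finite_subset)
  have "simple_graph (incident_vertices F) F"
    unfolding simple_graph_def
  proof (intro conjI ballI)
    show "finite (incident_vertices F)" using sub fV by (rule finite_subset)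
    show "incident_vertices F \<noteq> {}"
      using assms(3) ends by (fastforce simp: incident_vertices_def)
    fix e assume e: "e \<in> F"
    then have "e \<subseteq> incident_vertices F" by (auto simp: incident_vertices_def)
    then show "\<exists>u\<in>incident_vertices F. \<exists>v\<in>incident_vertices F. u \<noteq> v \<and> e = {u, v}"
      using ends[OF e] by blast
  qed
  moreover have "degree F v = 2" if v: "v \<in> incident_vertices F" for v
  proof -
    have "degree F v \<noteq> 0"
      using v fF by (auto simp: degree_def card_eq_0_iff incident_vertices_def)
    moreover have "v \<in> V" using v sub by blast
    ultimately show ?thesis using assms(4)[of v] by simp
  qed
  ultimately show ?thesis
    using sub assms(2) by (simp add: two_regular_subgraph_def subgraph_def)
qed

text \<open>Induction on \<open>k\<close>, removing one \<open>F\<close> at a time from the edges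
  while \<open>V\<close> stays fixed. The bound need not be attained, hence only
  \<open>card P \<le> k\<close>.\<close>

lemma even_graph_two_regular_partition:
  assumes "even_graph V E" "\<And>v. v \<in> V \<Longrightarrow> degree E v \<le> 2 * k"
  shows "\<exists>P. partition_on E P \<and> finite P \<and> card P \<le> k \<and>
    (\<forall>F\<in>P. two_regular_subgraph (incident_vertices F) F V E)"
  using assms
proof (induction k arbitrary: E)
  case 0
  have sg: "simple_graph V E" using "0.prems"(1) by (simp add: even_graph_def)
  have fE: "finite E" using sg by (rule simple_graph_finite_edges)
  have "E = {}"
  proof (rule equals0I)
    fix e assume e: "e \<in> E"
    then obtain v where "v \<in> V" "v \<in> e" using sg by (fastforce simp: simple_graph_def)
    then have "degree E v \<noteq> 0" using e fE by (auto simp: degree_def card_eq_0_iff)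
    then show False using "0.prems"(2)[OF \<open>v \<in> V\<close>] by simp
  qed
  then show ?case by (intro exI[of _ "{}"]) (simp add: partition_on_def)
next
  case (Suc k)
  have sg: "simple_graph V E" and ev: "\<And>v. v \<in> V \<Longrightarrow> even (degree E v)"
    using Suc.prems(1) by (auto simp: even_graph_def)
  have fE: "finite E" using sg by (rule simple_graph_finite_edges)
  obtain F where F: "F \<subseteq> E" "\<And>v. v \<in> V \<Longrightarrow> degree F v = 0 \<or> degree F v = 2"
      "\<And>v. v \<in> V \<Longrightarrow> degree E v = 2 * Suc k \<Longrightarrow> degree F v = 2"
    using even_graph_two_factor[of V E "Suc k"] Suc.prems by blast
  have degD: "degree (E - F) v = degree E v - degree F v" for v
    using fE F(1) by (rule degree_Diff)
  have sgD: "simple_graph V (E - F)" using sg by (auto simp: simple_graph_def)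
  have "even_graph V (E - F)"
    unfolding even_graph_def
  proof (intro conjI ballI)
    fix v assume "v \<in> V"
    then show "even (degree (E - F) v)" using degD[of v] ev[of v] F(2)[of v] by auto
  qed (rule sgD)
  moreover have "degree (E - F) v \<le> 2 * k" if v: "v \<in> V" for v
  proof (cases "degree E v = 2 * Suc k")
    case True
    then show ?thesis using degD[of v] F(3)[OF v] by simp
  next
    case False
    \<comment> \<open>By parity, a degree below \<open>2 * Suc k\<close> is already at most
      \<open>2 * k\<close>, whether or not \<open>F\<close> meets \<open>v\<close>.\<close>
    obtain m where m: "degree E v = 2 * m" using ev[OF v] by blast
    then have "m \<le> k" using False Suc.prems(2)[OF v] by simp
    then show ?thesis using degD[of v] m by simp
  qed
  ultimately obtain P where P: "partition_on (E - F) P" "finite P" "card P \<le> k"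
      "\<And>H. H \<in> P \<Longrightarrow> two_regular_subgraph (incident_vertices H) H V (E - F)"
    using Suc.IH by blast
  have PE: "two_regular_subgraph (incident_vertices H) H V E" if "H \<in> P" for H
    using P(4)[OF that] by (auto simp: two_regular_subgraph_def subgraph_def)
  show ?case
  \<comment> \<open>An empty \<open>F\<close> cannot be a part of a partition; then \<open>P\<close>
    itself serves.\<close>
  proof (cases "F = {}")
    case True
    then show ?thesis using P PE by (intro exI[of _ P]) auto
  next
    case False
    have "partition_on E (insert F P)"
      using P(1) F(1) False by (auto simp: partition_on_def disjoint_def)
    moreover have "card (insert F P) \<le> Suc k" using P(2,3) by (simp add: card_insert_if)
    moreover have "two_regular_subgraph (incident_vertices F) F V E"
      using sg F(1) False F(2) by (rule two_regular_subgraph_incident_vertices)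
    ultimately show ?thesis using P(2) PE by (intro exI[of _ "insert F P"]) auto
  qed
qed

section \<open>The lower bound and the conclusion\<close>

lemma degree_le_re_decomposition:
  assumes "simple_graph V E" "re_decomposition V E P"
  shows "degree E v \<le> 2 * card P"
proof -
  have part: "partition_on E P" using assms(2) by (simp add: re_decomposition_def)
  have fE: "finite E" using assms(1) by (rule simple_graph_finite_edges)
  have fP: "finite P" using fE part by (rule finite_elements)
  have "degree F v \<le> 2" if F: "F \<in> P" for F
  proof -
    consider "two_regular_subgraph (incident_vertices F) F V E" | e where "F = {e}"
      using assms(2) F by (auto simp: re_decomposition_def)
    then show ?thesis
    proof cases
      case 1
      show ?thesis
      proof (cases "v \<in> incident_vertices F")
        case True
        then show ?thesis using 1 by (simp add: two_regular_subgraph_def)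
      next
        case False
        then have "{e \<in> F. v \<in> e} = {}" by (auto simp: incident_vertices_def)
        then show ?thesis by (simp only: degree_def card.empty le0)
      qed
    next
      case 2
      then have "degree F v \<le> card {e}"
        unfolding degree_def by (intro card_mono) auto
      then show ?thesis by simp
    qed
  qed
  then have "(\<Sum>F\<in>P. degree F v) \<le> 2 * card P"
    using sum_bounded_above[of P "\<lambda>F. degree F v" 2] by (simp add: mult.commute)
  moreover have "degree E v \<le> (\<Sum>F\<in>P. degree F v)"
  proof -
    have eq: "{e \<in> E. v \<in> e} = (\<Union>F\<in>P. {e \<in> F. v \<in> e})"
      using part by (auto simp: partition_on_def)
    show ?thesis unfolding degree_def eq using fP by (rule card_UN_le)
  qed
  ultimately show ?thesis by linarith
qed

theorem theorem1p5:
  fixes V :: "'a set" and E :: "'a set set" and \<Delta> :: nat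
  assumes "even_graph V E"
    and "\<Delta> = max_degree V E"
  shows "(\<exists>P. partition_on E P \<and> real (card P) = real \<Delta> / 2 \<and>
            (\<forall>F\<in>P. \<exists>W. two_regular_subgraph W F V E)) \<and>
         real (f_re V E) = real \<Delta> / 2"
proof -
  have sg: "simple_graph V E" using assms(1) by (simp add: even_graph_def)
  then have V: "finite V" "V \<noteq> {}" by (auto simp: simple_graph_def)
  have le: "degree E v \<le> \<Delta>" if "v \<in> V" for v
    using that V by (simp add: assms(2) max_degree_def)
  have "\<Delta> \<in> degree E ` V"
    unfolding assms(2) max_degree_def using V by (intro Max_in) auto
  then obtain v where v: "v \<in> V" "degree E v = \<Delta>" by blast
  then obtain k where k: "\<Delta> = 2 * k" using assms(1) by (auto simp: even_graph_def)
  have lower: "k \<le> card P" if "re_decomposition V E P" for P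
    using degree_le_re_decomposition[OF sg that, of v] v(2) k by simp
  obtain P where P: "partition_on E P" "card P \<le> k"
      "\<forall>F\<in>P. two_regular_subgraph (incident_vertices F) F V E"
    using even_graph_two_regular_partition[OF assms(1), of k] le k by blast
  have re: "re_decomposition V E P" using P by (simp add: re_decomposition_def)
  then have card: "card P = k" using lower P(2) by (simp add: le_antisym)
  have "f_re V E \<le> k"
    unfolding f_re_def using re card by (intro Least_le) blast
  \<comment> \<open>The bound \<open>lower\<close> concerns actual decompositions, so the minimum
    must be attained by one.\<close>
  moreover have "k \<le> f_re V E" using f_re_attained[of V E] lower by metis
  ultimately show ?thesis using P(1,3) card k by (auto simp: field_simps)
qed

end
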